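(* Let $\alpha>0$ and suppose that $A$ is the generator of an $\alpha$-resolvent family $(S_\alpha(t))_{t>0}$ on a Banach space $X$, of exponential bound less than $1$; that is, there exist $M>0$ and $\omega<1$ such that $\|S_\alpha(t)\|\le Me^{\omega t}$ for all $t>0$. Then $A$ is the generator of a discrete $\alpha$-resolvent family $(\mathcal{S}_\alpha(n))_{n\in\mathbb{N}_0}$ defined by $$\mathcal{S}_\alpha(n)x:=\mathcal{P}(S_\alpha)(n)x=\int_0^\infty e^{-t}\frac{t^n}{n!}S_\alpha(t)x\,dt,\qquad n\in\mathbb{N}_0,\ x\in X.$$
   Context: $\mathbb{N}_0=\{0,1,2,\dots\}$; $X$ is a complex Banach space; $\mathcal{B}(X)$ is the space of bounded linear operators on $X$; $\rho(A)$ is the resolvent set of $A$. Let $A$ be a closed linear operator with domain $D(A)\subset X$ and $\alpha>0$. $A$ is called the generator of an $\alpha$-resolvent family if there exist $\omega_0\ge0$ and a strongly continuous function $S_\alpha:[0,\infty)\to\mathcal{B}(X)$ (respectively $S_\alpha:(0,\infty)\to\mathcal{B}(X)$ in case $0<\alpha<1$) such that $\{\lambda^\alpha:\mathrm{Re}\,\lambda>\omega_0\}\subset\rho(A)$ and $(\lambda^\alpha-A)^{-1}x=\int_0^\infty e^{-\lambda t}S_\alpha(t)x\,dt$ for $\mathrm{Re}\,\lambda>\omega_0$, $x\in X$. In this case $S_\alpha$ is called the $\alpha$-resolvent family generated by $A$. For $\beta>0$ and $n\in\mathbb{N}_0$, $k^{\beta}(n):=\frac{\Gamma(\beta+n)}{\Gamma(\beta)\Gamma(n+1)}$;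 for sequences, $(a*v)(n):=\sum_{j=0}^n a(n-j)v(j)$. A sequence $\{\mathcal{S}_\alpha(n)\}_{n\in\mathbb{N}_0}\subset\mathcal{B}(X)$ is called a discrete $\alpha$-resolvent family generated by $A$ if: (i) $\mathcal{S}_\alpha(n)x\in D(A)$ and $\mathcal{S}_\alpha(n)Ax=A\mathcal{S}_\alpha(n)x$ for all $n\in\mathbb{N}_0$, $x\in D(A)$; (ii) $(k^\alpha*\mathcal{S}_\alpha)(n)x\in D(A)$ and $\mathcal{S}_\alpha(n)x=k^\alpha(n)x+A(k^\alpha*\mathcal{S}_\alpha)(n)x$ for all $n\in\mathbb{N}_0$, $x\in X$. *)

theory Defs
  imports "HOL-Analysis.Analysis"
begin

class complex_banach = banach +
  fixes scaleC :: "complex \<Rightarrow> 'a \<Rightarrow> 'a" (infixr "*\<^sub>C" 75)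
  assumes scaleC_add_right: "a *\<^sub>C (x + y) = a *\<^sub>C x + a *\<^sub>C y"
    and scaleC_add_left: "(a + b) *\<^sub>C x = a *\<^sub>C x + b *\<^sub>C x"
    and scaleC_scaleC: "a *\<^sub>C b *\<^sub>C x = (a * b) *\<^sub>C x"
    and scaleC_of_real: "complex_of_real r *\<^sub>C x = r *\<^sub>R x"
    and norm_scaleC: "norm (a *\<^sub>C x) = cmod a * norm x"

instantiation complex :: complex_banach
begin

definition scaleC_complex :: "complex \<Rightarrow> complex \<Rightarrow> complex"
  where "scaleC_complex a x = a * x"

instance
  by standard (simp_all add: scaleC_complex_def algebra_simps norm_mult scaleR_conv_of_real)

end

definition bounded_clinear :: "('a::complex_banach \<Rightarrow> 'a) \<Rightarrow> bool"
  where "bounded_clinear T \<longleftrightarrow> bounded_linear T \<and> (\<forall>c x. T (c *\<^sub>C x) = c *\<^sub>C T x)"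

text \<open>A possibly unbounded operator is given by its domain \<open>D\<close> together with a total function
  \<open>A\<close>, whose values outside \<open>D\<close> are irrelevant.\<close>

definition closed_linear_operator :: "'a::complex_banach set \<Rightarrow> ('a \<Rightarrow> 'a) \<Rightarrow> bool"
  where "closed_linear_operator D A \<longleftrightarrow>
    0 \<in> D \<and>
    (\<forall>x\<in>D. \<forall>y\<in>D. x + y \<in> D \<and> A (x + y) = A x + A y) \<and>
    (\<forall>c. \<forall>x\<in>D. c *\<^sub>C x \<in> D \<and> A (c *\<^sub>C x) = c *\<^sub>C A x) \<and>
    closed ((\<lambda>x. (x, A x)) ` D)"

definition resolvent :: "'a::complex_banach set \<Rightarrow> ('a \<Rightarrow> 'a) \<Rightarrow> complex \<Rightarrow> 'a \<Rightarrow> 'a"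
  where "resolvent D A \<mu> = inv_into D (\<lambda>x. \<mu> *\<^sub>C x - A x)"

definition resolvent_set :: "'a::complex_banach set \<Rightarrow> ('a \<Rightarrow> 'a) \<Rightarrow> complex set"
  where "resolvent_set D A =
    {\<mu>. bij_betw (\<lambda>x. \<mu> *\<^sub>C x - A x) D UNIV \<and> bounded_clinear (resolvent D A \<mu>)}"

definition family_times :: "real \<Rightarrow> real set"
  where "family_times \<alpha> = (if \<alpha> < 1 then {0<..} else {0..})"

text \<open>Here \<open>z powr \<alpha>\<close> is the principal branch. As the Bochner integral of the library is
  restricted to separable spaces, vector-valued integrals are Henstock--Kurzweil integrals. On
  functions that are continuous on \<open>(0,\<infinity>)\<close> these extend both the Bochner integral and the
  improper (conditionally convergent) integral.\<close>

definition resolvent_family ::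
    "real \<Rightarrow> 'a::complex_banach set \<Rightarrow> ('a \<Rightarrow> 'a) \<Rightarrow> (real \<Rightarrow> 'a \<Rightarrow> 'a) \<Rightarrow> bool"
  where "resolvent_family \<alpha> D A S \<longleftrightarrow>
    closed_linear_operator D A \<and>
    (\<forall>t\<in>family_times \<alpha>. bounded_clinear (S t)) \<and>
    (\<forall>x. continuous_on (family_times \<alpha>) (\<lambda>t. S t x)) \<and>
    (\<exists>\<omega>\<^sub>0\<ge>0. \<forall>z. Re z > \<omega>\<^sub>0 \<longrightarrow>
      z powr complex_of_real \<alpha> \<in> resolvent_set D A \<and>
      (\<forall>x. ((\<lambda>t. exp (- (z * complex_of_real t)) *\<^sub>C S t x)
             has_integral resolvent D A (z powr complex_of_real \<alpha>) x) {0<..}))"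

definition cesaro_kernel :: "real \<Rightarrow> nat \<Rightarrow> real"
  where "cesaro_kernel \<beta> n = Gamma (\<beta> + real n) / (Gamma \<beta> * Gamma (real n + 1))"

definition seq_conv ::
    "(nat \<Rightarrow> real) \<Rightarrow> (nat \<Rightarrow> 'a::complex_banach \<Rightarrow> 'a) \<Rightarrow> nat \<Rightarrow> 'a \<Rightarrow> 'a"
  where "seq_conv a V n x = (\<Sum>j=0..n. a (n - j) *\<^sub>R V j x)"

definition discrete_resolvent_family ::
    "real \<Rightarrow> 'a::complex_banach set \<Rightarrow> ('a \<Rightarrow> 'a) \<Rightarrow> (nat \<Rightarrow> 'a \<Rightarrow> 'a) \<Rightarrow> bool"
  where "discrete_resolvent_family \<alpha> D A V \<longleftrightarrow>
    (\<forall>n. bounded_clinear (V n)) \<and>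
    (\<forall>n. \<forall>x\<in>D. V n x \<in> D \<and> V n (A x) = A (V n x)) \<and>
    (\<forall>n x. seq_conv (cesaro_kernel \<alpha>) V n x \<in> D \<and>
      V n x = cesaro_kernel \<alpha> n *\<^sub>R x + A (seq_conv (cesaro_kernel \<alpha>) V n x))"

definition poisson_integrand ::
    "(real \<Rightarrow> 'a::complex_banach \<Rightarrow> 'a) \<Rightarrow> nat \<Rightarrow> 'a \<Rightarrow> real \<Rightarrow> 'a"
  where "poisson_integrand S n x t = (exp (- t) * t ^ n / fact n) *\<^sub>R S t x"

definition poisson_transform ::
    "(real \<Rightarrow> 'a::complex_banach \<Rightarrow> 'a) \<Rightarrow> nat \<Rightarrow> 'a \<Rightarrow> 'a"
  where "poisson_transform S n x = integral {0<..} (poisson_integrand S n x)"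

end

theory Submission
  imports Defs "HOL-Real_Asymp.Real_Asymp"
begin

text \<open>Formally, the Laplace transform \<open>L(s)x = \<integral> exp (-st) S(t)x dt\<close> equals \<open>(s\<^sup>\<alpha> - A)\<^sup>-\<^sup>1x\<close>.
  Its expansion about \<open>1\<close> is \<open>L(1 - h)x = \<Sum> h\<^sup>n P(n)x\<close>, where \<open>P\<close> is the Poisson transform of \<open>S\<close>,
  and \<open>(1 - h)\<^sup>-\<^sup>\<alpha> = \<Sum> h\<^sup>n k\<^sup>\<alpha>(n)\<close> is the binomial series. Dividing \<open>(s\<^sup>\<alpha> - A) L(s)x = x\<close> by
  \<open>s\<^sup>\<alpha>\<close> and comparing the coefficients of \<open>h\<^sup>n\<close> gives the equation
  \<open>P(n)x = k\<^sup>\<alpha>(n)x + A(k\<^sup>\<alpha> * P)(n)x\<close> that defines a discrete resolvent family.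

  There are two obstacles: \<open>A\<close> is unbounded, and the Laplace transform is known to be the resolvent
  only for \<open>s > \<omega>\<^sub>0\<close>, where \<open>\<omega>\<^sub>0\<close> may exceed \<open>1\<close>. Both disappear if \<open>A\<close> is replaced by one bounded
  resolvent \<open>R = (\<mu> - A)\<^sup>-\<^sup>1\<close>. For \<open>s > \<omega>\<^sub>0\<close> the resolvent identity (\<open>resolvent_identity\<close>) reads
  \<open>L(s)x = Rx - (s\<^sup>\<alpha> - \<mu>) R L(s)x\<close>, and \<open>L(s)R = R L(s)\<close>. All terms here are analytic on the
  half-line \<open>s > max \<omega> 0\<close>, which contains \<open>1\<close>, so the identities persist there
  (\<open>taylor_on_ray_identity\<close>), and their coefficients at \<open>1\<close> give
  \<open>(k\<^sup>\<alpha> * P)(n)x = R(k\<^sup>\<alpha>(n)x - P(n)x + \<mu> (k\<^sup>\<alpha> * P)(n)x)\<close> and \<open>P(n)R = RP(n)\<close>. Applying \<open>\<mu> - A\<close>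
  to the first gives the resolvent equation, and the second gives commutation with \<open>A\<close>.

  Only real \<open>s\<close> occurs, and analyticity is expressed by power series (\<open>taylor_on_ray\<close>). Its three
  sources are \<open>taylor_on_ray_laplace\<close>, \<open>taylor_on_ray_powr\<close> and, for the products of the two, the
  Cauchy product \<open>taylor_on_ray_scaleR\<close>.\<close>

section \<open>Power series with coefficients in a Banach space\<close>

text \<open>The double series over all pairs \<open>(j, i)\<close> converges absolutely, hence unconditionally; it is
  summed once along rows and once along the diagonals \<open>i + j = n\<close>.\<close>
lemma Cauchy_product_scaleR_sums:
  fixes a :: "nat \<Rightarrow> real" and b :: "nat \<Rightarrow> 'a::banach"
  assumes a: "summable (\<lambda>k. norm (a k))" "a sums x"
    and b: "summable (\<lambda>k. norm (b k))" "b sums y"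
  shows "(\<lambda>n. \<Sum>j=0..n. a (n - j) *\<^sub>R b j) sums (x *\<^sub>R y)"
proof -
  let ?g = "\<lambda>(j, i). a i *\<^sub>R b j"
  have sa: "(\<lambda>i. \<bar>a i\<bar>) summable_on UNIV" and sb: "(\<lambda>j. norm (b j)) summable_on UNIV"
    using a(1) b(1) by (auto intro!: norm_summable_imp_summable_on)
  have "?g abs_summable_on UNIV \<times> UNIV"
    by (subst Infinite_Sum.abs_summable_on_Sigma_iff)
       (use sa sb in \<open>auto intro!: summable_on_cmult_left summable_on_cmult_right simp: infsum_cmult_left' infsum_nonneg\<close>)
  then have "?g summable_on UNIV \<times> UNIV"
    by (rule Infinite_Sum.abs_summable_summable)
  then obtain S where S: "(?g has_sum S) (UNIV \<times> UNIV)"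
    by (auto simp: summable_on_def)
  have "((\<lambda>j. x *\<^sub>R b j) has_sum S) UNIV"
    using norm_summable_imp_has_sum[OF a]
    by (intro has_sum_SigmaD[OF S]) (auto intro!: has_sum_bounded_linear[OF bounded_linear_scaleR_left])
  moreover have "((\<lambda>j. x *\<^sub>R b j) has_sum x *\<^sub>R y) UNIV"
    by (intro has_sum_scaleR norm_summable_imp_has_sum[OF b])
  ultimately have S_eq: "S = x *\<^sub>R y"
    by (rule has_sum_unique)
  have "((\<lambda>(n, j). a (n - j) *\<^sub>R b j) has_sum S) (SIGMA n:UNIV. {0..n})"
    using S
    by (rule has_sum_reindex_bij_witness[where i = "\<lambda>(j, i). (j + i, j)" and
          j = "\<lambda>(n, j). (j, n - j)", THEN iffD2, rotated 6]) auto
  then have "((\<lambda>n. \<Sum>j=0..n. a (n - j) *\<^sub>R b j) has_sum S) UNIV"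
    by (rule has_sum_SigmaD) (auto intro: has_sum_finite)
  then show ?thesis
    unfolding S_eq by (rule has_sum_imp_sums)
qed

lemma powser_norm_summable:
  fixes c :: "nat \<Rightarrow> 'a::banach"
  assumes "summable (\<lambda>n. r ^ n *\<^sub>R c n)" and "\<bar>h\<bar> < \<bar>r\<bar>"
  shows "summable (\<lambda>n. norm (h ^ n *\<^sub>R c n))"
proof -
  obtain K where K: "norm (r ^ n *\<^sub>R c n) \<le> K" for n
    using summable_imp_bounded[OF assms(1)] by (auto simp: bounded_iff)
  have r: "\<bar>r\<bar> > 0"
    using assms(2) by linarith
  have bound: "norm (norm (h ^ n *\<^sub>R c n)) \<le> K * (\<bar>h\<bar> / \<bar>r\<bar>) ^ n" for n
    using mult_left_mono[OF K[of n], of "(\<bar>h\<bar> / \<bar>r\<bar>) ^ n"] r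
    by (simp add: power_divide power_abs mult.commute)
  have "summable (\<lambda>n. K * (\<bar>h\<bar> / \<bar>r\<bar>) ^ n)"
    using r assms(2) by (intro summable_mult summable_geometric) simp
  then show ?thesis
    by (rule summable_comparison_test'[of _ 0]) (rule bound)
qed

text \<open>Apart from its constant term, the series is \<open>O(h)\<close> as \<open>h\<close> tends to \<open>0\<close> from the right. The value
  \<open>h = 0\<close>, which would give the conclusion at once, is left out so that the hypothesis passes on to
  the shifted series, whose sum is known only after division by \<open>h\<close>.\<close>
lemma powser_zero_imp_constant_coeff_zero:
  fixes c :: "nat \<Rightarrow> 'a::banach"
  assumes "r > 0" and sums: "\<And>h. 0 < h \<Longrightarrow> h < r \<Longrightarrow> (\<lambda>n. h ^ n *\<^sub>R c n) sums 0"
  shows "c 0 = 0"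
proof -
  define q where "q = r / 2"
  define B where "B = (\<Sum>n. norm (q ^ n *\<^sub>R c (Suc n)))"
  have q: "0 < q" "q < r"
    using assms(1) by (auto simp: q_def)
  have "summable (\<lambda>n. norm (q ^ Suc n *\<^sub>R c (Suc n)))"
    using powser_norm_summable[OF sums_summable[OF sums[of "3 * r / 4"]], of q] assms(1)
    by (subst summable_Suc_iff) (simp add: q_def)
  then have "summable (\<lambda>n. inverse q * norm (q ^ Suc n *\<^sub>R c (Suc n)))"
    by (rule summable_mult)
  then have sB: "summable (\<lambda>n. norm (q ^ n *\<^sub>R c (Suc n)))"
    using q(1) by (simp add: field_simps)
  have bound: "norm (c 0) \<le> h * B" if h: "0 < h" "h \<le> q" for h
  proof -
    have le: "norm (h ^ Suc n *\<^sub>R c (Suc n)) \<le> h * norm (q ^ n *\<^sub>R c (Suc n))" for n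
      using power_mono[OF h(2), of n] h q by (simp add: mult_left_mono mult_right_mono)
    have "(\<lambda>n. h ^ Suc n *\<^sub>R c (Suc n)) sums - c 0"
      using sums[of h] h q by (subst sums_Suc_iff) simp
    then have "norm (- c 0) \<le> (\<Sum>n. h * norm (q ^ n *\<^sub>R c (Suc n)))"
      using norm_suminf_le[OF le summable_mult[OF sB]] by (simp add: sums_iff)
    also have "\<dots> = h * B"
      unfolding B_def by (rule suminf_mult[OF sB])
    finally show ?thesis by simp
  qed
  have "((\<lambda>h. h * B) \<longlongrightarrow> 0 * B) (at_right 0)"
    by (intro tendsto_intros)
  moreover have "\<forall>\<^sub>F h in at_right 0. norm (c 0) \<le> h * B"
    using eventually_at_right_real[OF q(1)] by eventually_elim (auto intro!: bound)
  ultimately have "norm (c 0) \<le> 0 * B"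
    by (rule tendsto_lowerbound) simp
  then show ?thesis by simp
qed

lemma powser_zero_imp_coeff_zero:
  fixes c :: "nat \<Rightarrow> 'a::banach"
  assumes "r > 0" and "\<And>h. 0 < h \<Longrightarrow> h < r \<Longrightarrow> (\<lambda>n. h ^ n *\<^sub>R c n) sums 0"
  shows "c n = 0"
  using assms(2)
proof (induction n arbitrary: c)
  case 0
  then show ?case
    using powser_zero_imp_constant_coeff_zero[OF assms(1)] by blast
next
  case (Suc n)
  have c0: "c 0 = 0"
    using powser_zero_imp_constant_coeff_zero[OF assms(1) Suc.prems] by blast
  have "(\<lambda>n. h ^ n *\<^sub>R c (Suc n)) sums 0" if h: "0 < h" "h < r" for h
  proof -
    have "(\<lambda>n. h ^ Suc n *\<^sub>R c (Suc n)) sums 0"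
      using Suc.prems[OF h] c0 by (subst sums_Suc_iff) simp
    from sums_scaleR_right[OF this, of "inverse h"] show ?thesis
      using h by (simp flip: mult.assoc)
  qed
  then show ?case
    by (rule Suc.IH)
qed

section \<open>Analyticity on a half-line\<close>

text \<open>A real-variable substitute for holomorphy on the half-plane \<open>Re z > a\<close>: the power series about
  each centre \<open>s > a\<close> converges to \<open>F\<close> on the whole interval of radius \<open>s - a\<close>, just as the Taylor
  series of a holomorphic function would. The minus sign in \<open>F (s - h)\<close> makes the coefficients of a
  Laplace transform the Poisson-type moments without alternating signs.\<close>
definition taylor_on_ray :: "real \<Rightarrow> (real \<Rightarrow> 'a::banach) \<Rightarrow> (real \<Rightarrow> nat \<Rightarrow> 'a) \<Rightarrow> bool"
  where "taylor_on_ray a F c \<longleftrightarrow>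
    (\<forall>s>a. \<forall>h. \<bar>h\<bar> < s - a \<longrightarrow> (\<lambda>n. h ^ n *\<^sub>R c s n) sums F (s - h))"

lemma taylor_on_rayD:
  "taylor_on_ray a F c \<Longrightarrow> \<bar>h\<bar> < s - a \<Longrightarrow> (\<lambda>n. h ^ n *\<^sub>R c s n) sums F (s - h)"
  by (force simp: taylor_on_ray_def)

lemma taylor_on_ray_mono: "taylor_on_ray a F c \<Longrightarrow> a \<le> b \<Longrightarrow> taylor_on_ray b F c"
  by (force simp: taylor_on_ray_def)

lemma taylor_on_ray_add:
  assumes "taylor_on_ray a F c" "taylor_on_ray a G d"
  shows "taylor_on_ray a (\<lambda>s. F s + G s) (\<lambda>s n. c s n + d s n)"
  using assms by (force simp: taylor_on_ray_def scaleR_add_right intro!: sums_add)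

lemma taylor_on_ray_diff:
  assumes "taylor_on_ray a F c" "taylor_on_ray a G d"
  shows "taylor_on_ray a (\<lambda>s. F s - G s) (\<lambda>s n. c s n - d s n)"
  using assms by (force simp: taylor_on_ray_def scaleR_diff_right intro!: sums_diff)

lemma taylor_on_ray_bounded_linear:
  assumes "bounded_linear T" "taylor_on_ray a F c"
  shows "taylor_on_ray a (\<lambda>s. T (F s)) (\<lambda>s n. T (c s n))"
  unfolding taylor_on_ray_def
proof (intro allI impI)
  fix s h assume "\<bar>h\<bar> < s - a"
  from bounded_linear.sums[OF assms(1) taylor_on_rayD[OF assms(2) this]]
  show "(\<lambda>n. h ^ n *\<^sub>R T (c s n)) sums T (F (s - h))"
    by (simp add: linear_cmul[OF bounded_linear.linear[OF assms(1)]])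
qed

lemma taylor_on_ray_norm_summable:
  assumes "taylor_on_ray a F c" "\<bar>h\<bar> < s - a"
  shows "summable (\<lambda>n. norm (h ^ n *\<^sub>R c s n))"
proof -
  obtain r where r: "\<bar>h\<bar> < r" "r < s - a"
    using dense[OF assms(2)] by blast
  then have "\<bar>r\<bar> < s - a" by linarith
  from sums_summable[OF taylor_on_rayD[OF assms(1) this]] show ?thesis
    by (rule powser_norm_summable) (use r in linarith)
qed

text \<open>Analytic continuation in a single step: a centre \<open>v\<close> far to the right has a neighbourhood on which
  \<open>F\<close> and \<open>G\<close> agree, so the coefficients at \<open>v\<close> agree; the interval of convergence at \<open>v\<close> reaches back to
  \<open>a\<close>, hence \<open>F = G\<close> on the whole ray and the coefficients agree at every centre.\<close>
lemma taylor_on_ray_identity: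
  assumes F: "taylor_on_ray a F c" and G: "taylor_on_ray a G d"
    and eq: "\<forall>s>b. F s = G s" and "a < s"
  shows "c s n = d s n"
proof -
  let ?e = "\<lambda>s n. c s n - d s n"
  note E = taylor_on_ray_diff[OF F G]
  have ray: "F u = G u" if u: "a < u" for u
  proof -
    define v where "v = max b u + 1"
    have v: "u < v" "b < v" "a < v" using u by (auto simp: v_def)
    have "?e v n = 0" for n
    proof (rule powser_zero_imp_coeff_zero)
      show "0 < min (v - b) (v - a)" using v by simp
      show "(\<lambda>n. h ^ n *\<^sub>R ?e v n) sums 0" if "0 < h" "h < min (v - b) (v - a)" for h
        using taylor_on_rayD[OF E, of h v] eq[rule_format, of "v - h"] that by simp
    qed
    moreover have "(\<lambda>n. (v - u) ^ n *\<^sub>R ?e v n) sums (F u - G u)"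
      using taylor_on_rayD[OF E, of "v - u" v] u v by simp
    ultimately show ?thesis
      by (simp add: sums_iff)
  qed
  have "?e s n = 0"
  proof (rule powser_zero_imp_coeff_zero)
    show "0 < s - a" using \<open>a < s\<close> by simp
    show "(\<lambda>n. h ^ n *\<^sub>R ?e s n) sums 0" if "0 < h" "h < s - a" for h
      using taylor_on_rayD[OF E, of h s] ray[of "s - h"] that by simp
  qed
  then show ?thesis by simp
qed

lemma taylor_on_ray_scaleR:
  assumes "taylor_on_ray a k d" "taylor_on_ray a F c"
  shows "taylor_on_ray a (\<lambda>s. k s *\<^sub>R F s) (\<lambda>s n. \<Sum>j=0..n. d s (n - j) *\<^sub>R c s j)"
  unfolding taylor_on_ray_def
proof (intro allI impI)
  fix s h assume "\<bar>h\<bar> < s - a"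
  note h = this
  have "(\<lambda>n. \<Sum>j=0..n. (h ^ (n - j) *\<^sub>R d s (n - j)) *\<^sub>R h ^ j *\<^sub>R c s j)
      sums (k (s - h) *\<^sub>R F (s - h))"
    using assms h by (intro Cauchy_product_scaleR_sums)
      (blast intro: taylor_on_ray_norm_summable taylor_on_rayD)+
  moreover have "(\<Sum>j=0..n. (h ^ (n - j) *\<^sub>R d s (n - j)) *\<^sub>R h ^ j *\<^sub>R c s j) =
      h ^ n *\<^sub>R (\<Sum>j=0..n. d s (n - j) *\<^sub>R c s j)" for n
    by (auto simp: scaleR_sum_right intro!: sum.cong simp flip: power_add)
  ultimately show "(\<lambda>n. h ^ n *\<^sub>R (\<Sum>j=0..n. d s (n - j) *\<^sub>R c s j)) sums (k (s - h) *\<^sub>R F (s - h))"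
    by simp
qed

lemma cesaro_kernel_pochhammer:
  assumes "\<alpha> > 0"
  shows "cesaro_kernel \<alpha> n = pochhammer \<alpha> n / fact n"
proof -
  have "\<alpha> \<notin> \<int>\<^sub>\<le>\<^sub>0"
    using assms by (auto elim!: nonpos_Ints_cases)
  then show ?thesis
    using Gamma_fact[of n, where ?'a = real]
    by (simp add: cesaro_kernel_def pochhammer_Gamma add.commute[of 1])
qed

text \<open>The binomial series \<open>(1 - h)\<^sup>-\<^sup>\<alpha> = \<Sum> k\<^sup>\<alpha>(n) h\<^sup>n\<close>, rescaled to the centre \<open>s\<close>. It makes the
  kernel \<open>k\<^sup>\<alpha>\<close> of the discrete family appear as the coefficient sequence of \<open>s\<^sup>-\<^sup>\<alpha>\<close>
  at \<open>s = 1\<close>.\<close>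
lemma taylor_on_ray_powr:
  assumes "\<alpha> > 0" "0 \<le> a"
  shows "taylor_on_ray a (\<lambda>s. s powr - \<alpha>) (\<lambda>s n. s powr (- \<alpha> - real n) * cesaro_kernel \<alpha> n)"
  unfolding taylor_on_ray_def
proof (intro allI impI)
  fix s h :: real assume "a < s" and h: "\<bar>h\<bar> < s - a"
  have "(\<lambda>n. ((- \<alpha>) gchoose n) * s powr (- \<alpha> - real n) * (- h) ^ n) sums (s + - h) powr - \<alpha>"
    using h assms by (intro gen_binomial_real'') auto
  moreover have "((- \<alpha>) gchoose n) * s powr (- \<alpha> - real n) * (- h) ^ n =
      h ^ n *\<^sub>R (s powr (- \<alpha> - real n) * cesaro_kernel \<alpha> n)" for n
    by (simp add: cesaro_kernel_pochhammer[OF assms(1)] gbinomial_pochhammer power_minus[of h])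
  ultimately show "(\<lambda>n. h ^ n *\<^sub>R (s powr (- \<alpha> - real n) * cesaro_kernel \<alpha> n)) sums (s - h) powr - \<alpha>"
    by simp
qed

section \<open>Laplace transforms of exponentially bounded functions\<close>

text \<open>For Henstock--Kurzweil integrals with values in a Banach space, integrability near the possible
  singularity at \<open>0\<close> comes from the fundamental theorem of calculus: a bounded continuous function on
  \<open>(0,b]\<close> has a Lipschitz primitive there, which extends continuously to \<open>[0,b]\<close>.\<close>
lemma integrable_on_cbox_of_bounded_continuous:
  fixes f :: "real \<Rightarrow> 'a::banach"
  assumes cont: "continuous_on {0<..} f"
    and bdd: "\<And>b. \<exists>C. \<forall>t. 0 < t \<and> t \<le> b \<longrightarrow> norm (f t) \<le> C"
  shows "(\<lambda>t. if t \<in> {0<..} then f t else 0) integrable_on cbox a b"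
proof -
  have int: "f integrable_on {s..t}" if "0 < s" for s t
    using that by (intro integrable_continuous_real continuous_on_subset[OF cont]) auto
  have from_0: "f integrable_on {0..b}" if "0 < b"
  proof -
    obtain C where C: "norm (f t) \<le> C" if "0 < t" "t \<le> b" for t
      using bdd[of b] by blast
    define F where "F = (\<lambda>t. integral {t..b} f)"
    have F_diff: "F s - F t = integral {s..t} f" if "0 < s" "s \<le> t" "t \<le> b" for s t
      using Henstock_Kurzweil_Integration.integral_combine[OF that(2,3) int[OF that(1)]] by (simp add: F_def algebra_simps)
    have ineq: "dist (F s) (F t) \<le> C * dist s t"
      if "0 < s" "s \<le> t" "t \<le> b" for s t
    proof -
      have "norm (integral (cbox s t) f) \<le> C * measure lborel (cbox s t)"
        using that C[of b] \<open>0 < b\<close> norm_ge_zero[of "f b"] C[of t]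
        by (intro Henstock_Kurzweil_Integration.integrable_bound int[unfolded cbox_interval[symmetric]])
           (auto intro: order_trans[OF norm_ge_zero] C)
      then show ?thesis
        using that by (simp add: dist_norm F_diff)
    qed
    have "C-lipschitz_on {0<..b} F"
    proof (rule lipschitz_onI)
      show "dist (F s) (F t) \<le> C * dist s t" if "s \<in> {0<..b}" "t \<in> {0<..b}" for s t
        using ineq[of s t] ineq[of t s] that by (cases "s \<le> t") (auto simp: dist_commute)
      show "0 \<le> C"
        using C[of b] that norm_ge_zero[of "f b"] by linarith
    qed
    then have "uniformly_continuous_on {0<..b} F"
      by (rule lipschitz_on_uniformly_continuous)
    then obtain G where G: "uniformly_continuous_on (closure {0<..b}) G"
      and FG: "\<And>t. t \<in> {0<..b} \<Longrightarrow> F t = G t"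
      by (rule uniformly_continuous_on_extension_on_closure) blast
    have "continuous_on {0..b} G"
      using uniformly_continuous_imp_continuous[OF G] that by simp
    moreover have "(G has_vector_derivative - f t) (at t)" if t: "t \<in> {0<..<b}" for t
    proof -
      have "((\<lambda>u. integral {t/2..u} f) has_vector_derivative f t) (at t within {t/2..b})"
        using t by (intro integral_has_vector_derivative continuous_on_subset[OF cont]) auto
      then have "((\<lambda>u. F (t/2) - integral {t/2..u} f) has_vector_derivative - f t)
          (at t within {t/2..b})"
        by (auto intro!: derivative_eq_intros)
      then have "((\<lambda>u. F (t/2) - integral {t/2..u} f) has_vector_derivative - f t) (at t)"
        using t by (subst (asm) at_within_interior) (auto simp: interior_atLeastAtMost_real)
      then show ?thesis
      proof (rule has_vector_derivative_transform_within_open[where S = "{t/2<..<b}"])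
        fix u assume u: "u \<in> {t/2<..<b}"
        then have "F (t/2) - F u = integral {t/2..u} f"
          using t by (intro F_diff) auto
        then show "F (t/2) - integral {t/2..u} f = G u"
          using FG[of u] u t by (auto simp: algebra_simps)
      qed (use t in auto)
    qed
    ultimately have "((\<lambda>t. - f t) has_integral G b - G 0) {0..b}"
      using that by (intro fundamental_theorem_of_calculus_interior) auto
    then show ?thesis
      using integrable_neg by fastforce
  qed
  have "f integrable_on {0<..} \<inter> {a..b}"
  proof (cases "0 < a")
    case True
    then have "{0<..} \<inter> {a..b} = {a..b}" by auto
    then show ?thesis using int True by simp
  next
    case False
    show ?thesis
    proof (cases "0 < b")
      case True
      show ?thesis
        by (rule integrable_spike_set[OF from_0[OF True]])
           (rule negligible_subset[of "{0}"], use \<open>\<not> 0 < a\<close> in auto)+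
    next
      case F: False
      then have "{0<..} \<inter> {a..b} = {}" by auto
      then show ?thesis by (metis integrable_on_empty)
    qed
  qed
  then show ?thesis
    by (simp only: integrable_restrict_Int cbox_interval)
qed

text \<open>Integration by parts in the form \<open>e\<^sub>n\<^sub>+\<^sub>1' = e\<^sub>n - a e\<^sub>n\<^sub>+\<^sub>1\<close> for the functions
  \<open>e\<^sub>n(t) = exp (-at) t\<^sup>n / n!\<close> reduces each moment to the preceding one.\<close>
lemma has_integral_exp_moment:
  fixes a :: real
  assumes "0 < a"
  shows "((\<lambda>t. exp (- a * t) * t ^ n / fact n) has_integral 1 / a ^ Suc n) {0<..}"
proof -
  define e where "e = (\<lambda>n t. exp (- a * t) * t ^ n / fact n)"
  have int: "e n integrable_on {0..y}" for n y
    unfolding e_def by (intro integrable_continuous_real continuous_intros) auto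
  have lim: "((\<lambda>y. integral {0..y} (e n)) \<longlongrightarrow> 1 / a ^ Suc n) at_top" for n
  proof (induction n)
    case 0
    have "((\<lambda>y. exp (- a * 0) / a - exp (- a * y) / a) \<longlongrightarrow> 1 / a ^ Suc 0) at_top"
      using assms by real_asymp
    moreover have "integral {0..y} (e 0) = exp (- a * 0) / a - exp (- a * y) / a" if "0 \<le> y" for y
    proof -
      have "(e 0 has_integral (- exp (- a * y) / a) - (- exp (- a * 0) / a)) {0..y}"
        unfolding e_def using that assms
        by (intro fundamental_theorem_of_calculus)
           (auto intro!: derivative_eq_intros
              simp: has_real_derivative_iff_has_vector_derivative[symmetric])
      then show ?thesis
        by (simp add: integral_unique)
    qed
    ultimately show ?case
      by (auto elim!: Lim_transform_eventually intro!: eventually_mono[OF eventually_ge_at_top[of 0]])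
  next
    case (Suc n)
    have "((\<lambda>y. exp (- a * y) * y ^ Suc n) \<longlongrightarrow> 0) at_top"
      using assms by real_asymp
    then have "(e (Suc n) \<longlongrightarrow> 0) at_top"
      unfolding e_def by (rule tendsto_divide_zero)
    then have "((\<lambda>y. (integral {0..y} (e n) - e (Suc n) y) / a) \<longlongrightarrow> 1 / a ^ Suc (Suc n)) at_top"
      using tendsto_divide[OF tendsto_diff[OF Suc.IH \<open>(e (Suc n) \<longlongrightarrow> 0) at_top\<close>] tendsto_const[of a]] assms
      by (simp add: mult.commute)
    moreover have "integral {0..y} (e (Suc n)) = (integral {0..y} (e n) - e (Suc n) y) / a"
      if "0 \<le> y" for y
    proof -
      have deriv: "(e (Suc n) has_real_derivative e n t - a * e (Suc n) t) (at t within {0..y})" for t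
      proof -
        have "((\<lambda>t. t ^ Suc n / fact (Suc n)) has_real_derivative t ^ n / fact n) (at t within {0..y})"
          using DERIV_cdivide[OF DERIV_pow[of "Suc n"], of "fact (Suc n)"]
          by (simp del: power_Suc)
        moreover have "((\<lambda>t. exp (- a * t)) has_real_derivative - a * exp (- a * t)) (at t within {0..y})"
          by (auto intro!: derivative_eq_intros)
        ultimately show ?thesis
          unfolding e_def
          by (auto dest: DERIV_mult simp: algebra_simps simp del: power_Suc fact_Suc)
      qed
      have "((\<lambda>t. e n t - a * e (Suc n) t) has_integral e (Suc n) y - e (Suc n) 0) {0..y}"
        using that deriv
        by (intro fundamental_theorem_of_calculus)
           (auto simp: has_real_derivative_iff_has_vector_derivative[symmetric])
      then have "integral {0..y} (\<lambda>t. e n t - a * e (Suc n) t) = e (Suc n) y"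
        by (simp add: integral_unique e_def)
      also have "integral {0..y} (\<lambda>t. e n t - a * e (Suc n) t) =
          integral {0..y} (e n) - a * integral {0..y} (e (Suc n))"
        using int integrable_cmul[OF int[of "Suc n" y], of a]
        by (subst Henstock_Kurzweil_Integration.integral_diff) auto
      finally show ?thesis
        using assms by (simp add: field_simps)
    qed
    ultimately show ?case
      by (auto elim!: Lim_transform_eventually intro!: eventually_mono[OF eventually_ge_at_top[of 0]])
  qed
  have "(e n has_integral 1 / a ^ Suc n) {0..}"
    by (rule has_integral_to_inf[OF int lim]) (simp add: e_def)
  then have "(e n has_integral 1 / a ^ Suc n) {0<..}"
    by (rule has_integral_spike_set_eq[THEN iffD1, rotated 2])
       (rule negligible_subset[of "{0}"], auto)+
  then show ?thesis by (simp add: e_def)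
qed

text \<open>The bound keeps the remainder of the exponential series of \<open>\<bar>x\<bar>\<close> on the right instead of
  estimating it, because that remainder can be integrated exactly against \<open>exp (-bt)\<close>.\<close>
lemma exp_taylor_tail_le:
  fixes x :: real
  shows "\<bar>exp x - (\<Sum>n<N. x ^ n / fact n)\<bar> \<le> exp \<bar>x\<bar> - (\<Sum>n<N. \<bar>x\<bar> ^ n / fact n)"
proof -
  have tail: "(\<lambda>n. y ^ (n + N) / fact (n + N)) sums (exp y - (\<Sum>n<N. y ^ n / fact n))" for y :: real
    using sums_split_initial_segment[OF exp_converges[of y], of N]
    by (simp add: divide_inverse mult.commute)
  have "norm (x ^ (n + N) / fact (n + N)) \<le> \<bar>x\<bar> ^ (n + N) / fact (n + N)" for n
    by (simp add: power_abs)
  from norm_suminf_le[OF this sums_summable[OF tail]] show ?thesis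
    by (simp add: sums_unique[OF tail, symmetric])
qed

text \<open>The coefficient with index \<open>0\<close> is the Laplace transform of \<open>u\<close> at \<open>s\<close>, and the sequence at
  \<open>s = 1\<close> is the Poisson transform of \<open>u\<close>.\<close>
definition laplace_coeff :: "(real \<Rightarrow> 'a::banach) \<Rightarrow> real \<Rightarrow> nat \<Rightarrow> 'a"
  where "laplace_coeff u s n = integral {0<..} (\<lambda>t. (exp (- s * t) * t ^ n / fact n) *\<^sub>R u t)"

definition continuous_exp_bounded :: "real \<Rightarrow> real \<Rightarrow> (real \<Rightarrow> 'a::banach) \<Rightarrow> bool"
  where "continuous_exp_bounded K \<omega> u \<longleftrightarrow>
    continuous_on {0<..} u \<and> (\<forall>t>0. norm (u t) \<le> K * exp (\<omega> * t))"

context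
  fixes u :: "real \<Rightarrow> 'a::banach" and K \<omega> :: real
  assumes u: "continuous_exp_bounded K \<omega> u"
begin

lemma exp_bound: "0 < t \<Longrightarrow> norm (u t) \<le> K * exp (\<omega> * t)"
  using u by (simp add: continuous_exp_bounded_def)

lemma exp_bounded_const_nonneg: "0 \<le> K"
  using order_trans[OF norm_ge_zero exp_bound[of 1]] by (simp add: zero_le_mult_iff)

lemma norm_weighted_le:
  assumes "0 < t" "\<bar>w\<bar> * exp (\<omega> * t) \<le> g"
  shows "norm (w *\<^sub>R u t) \<le> K * g"
proof -
  have "norm (w *\<^sub>R u t) \<le> \<bar>w\<bar> * (K * exp (\<omega> * t))"
    using exp_bound[OF assms(1)] by (simp add: mult_left_mono)
  also have "\<dots> \<le> K * g"
    using mult_left_mono[OF assms(2) exp_bounded_const_nonneg] by (simp add: algebra_simps)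
  finally show ?thesis .
qed

lemma weighted_integrable:
  assumes w: "continuous_on UNIV w"
    and g: "g integrable_on {0<..}" "\<And>t. 0 < t \<Longrightarrow> \<bar>w t\<bar> * exp (\<omega> * t) \<le> g t"
  shows "(\<lambda>t. w t *\<^sub>R u t) integrable_on {0<..}"
    and "(\<lambda>t. norm (w t *\<^sub>R u t)) integrable_on {0<..}"
proof -
  let ?f = "\<lambda>t. w t *\<^sub>R u t"
  have le: "norm (?f t) \<le> K * g t" if "0 < t" for t
    using norm_weighted_le[OF that g(2)[OF that]] .
  have bdd: "\<exists>C. \<forall>t. 0 < t \<and> t \<le> b \<longrightarrow> norm (?f t) \<le> C" for b
  proof -
    have "compact ((\<lambda>t. \<bar>w t\<bar> * exp (\<omega> * t)) ` {0..b})"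
      by (intro compact_continuous_image continuous_intros continuous_on_subset[OF w]) auto
    then obtain C where "\<And>t. t \<in> {0..b} \<Longrightarrow> \<bar>w t\<bar> * exp (\<omega> * t) \<le> C"
      by (force dest!: compact_imp_bounded simp: bounded_iff)
    then have "norm (?f t) \<le> K * C" if "0 < t" "t \<le> b" for t
      using that by (intro norm_weighted_le) auto
    then show ?thesis by blast
  qed
  have f: "continuous_on {0<..} ?f"
    using u by (intro continuous_intros continuous_on_subset[OF w])
      (auto simp: continuous_exp_bounded_def)
  have Kg: "(\<lambda>t. K * g t) integrable_on {0<..}"
    using integrable_on_cmult_left[OF g(1), of K] by simp
  show "?f integrable_on {0<..}"
  proof (rule integrable_on_all_intervals_integrable_bound[OF _ _ Kg])
    show "(\<lambda>t. if t \<in> {0<..} then ?f t else 0) integrable_on cbox a b" for a b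
      by (rule integrable_on_cbox_of_bounded_continuous[OF f bdd])
  qed (rule le, simp)
  show "(\<lambda>t. norm (?f t)) integrable_on {0<..}"
  proof (rule integrable_on_all_intervals_integrable_bound[OF _ _ Kg])
    show "(\<lambda>t. if t \<in> {0<..} then norm (?f t) else 0) integrable_on cbox a b" for a b
      using bdd by (intro integrable_on_cbox_of_bounded_continuous continuous_on_norm f)
        (simp only: real_norm_def abs_norm_cancel)
    show "norm (norm (?f t)) \<le> K * g t" if "t \<in> {0<..}" for t
      using le[of t] that by (simp only: real_norm_def abs_norm_cancel greaterThan_iff)
  qed
qed

lemma laplace_coeff_integrable:
  assumes "\<omega> < s"
  shows "(\<lambda>t. (exp (- s * t) * t ^ n / fact n) *\<^sub>R u t) integrable_on {0<..}"
    and "(\<lambda>t. norm ((exp (- s * t) * t ^ n / fact n) *\<^sub>R u t)) integrable_on {0<..}"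
    and "norm (laplace_coeff u s n) \<le> K / (s - \<omega>) ^ Suc n"
proof -
  have mom: "((\<lambda>t. exp (- (s - \<omega>) * t) * t ^ n / fact n) has_integral 1 / (s - \<omega>) ^ Suc n) {0<..}"
    using assms by (intro has_integral_exp_moment) simp
  have le: "\<bar>exp (- s * t) * t ^ n / fact n\<bar> * exp (\<omega> * t) \<le> exp (- (s - \<omega>) * t) * t ^ n / fact n"
    if "0 < t" for t
    using that by (simp add: abs_mult left_diff_distrib exp_diff exp_minus field_simps)
  have w: "continuous_on UNIV (\<lambda>t. exp (- s * t) * t ^ n / fact n)"
    by (intro continuous_intros) auto
  show int: "(\<lambda>t. (exp (- s * t) * t ^ n / fact n) *\<^sub>R u t) integrable_on {0<..}"
    and "(\<lambda>t. norm ((exp (- s * t) * t ^ n / fact n) *\<^sub>R u t)) integrable_on {0<..}"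
    by (rule weighted_integrable[OF w has_integral_integrable[OF mom] le]; assumption)+
  have "norm (laplace_coeff u s n) \<le>
      integral {0<..} (\<lambda>t. K * (exp (- (s - \<omega>) * t) * t ^ n / fact n))"
    unfolding laplace_coeff_def
    using has_integral_integrable[OF has_integral_mult_right[OF mom, of K]]
    by (intro Henstock_Kurzweil_Integration.integral_norm_bound_integral int norm_weighted_le le) auto
  also have "\<dots> = K / (s - \<omega>) ^ Suc n"
    using integral_unique[OF has_integral_mult_right[OF mom, of K]] by simp
  finally show "norm (laplace_coeff u s n) \<le> K / (s - \<omega>) ^ Suc n" .
qed

text \<open>The remainder after \<open>N\<close> terms is an integral whose kernel is the Taylor remainder of \<open>exp (ht)\<close>.
  Against the bound \<open>K exp (\<omega>t)\<close> it is at most \<open>K\<close> times the remainder \<open>G N\<close> of the geometric series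
  for \<open>1 / (s - \<omega> - \<bar>h\<bar>)\<close>. This justifies integrating the exponential series termwise.\<close>
lemma taylor_on_ray_laplace:
  "taylor_on_ray \<omega> (\<lambda>s. laplace_coeff u s 0) (laplace_coeff u)"
  unfolding taylor_on_ray_def
proof (intro allI impI)
  fix s h assume s: "\<omega> < s" and h: "\<bar>h\<bar> < s - \<omega>"
  define e where "e = (\<lambda>b n t. exp (- b * t) * t ^ n / fact n :: real)"
  define w where "w = (\<lambda>N t. e (s - h) 0 t - (\<Sum>n<N. h ^ n * e s n t))"
  define g where "g = (\<lambda>N t. e (s - \<omega> - \<bar>h\<bar>) 0 t - (\<Sum>n<N. \<bar>h\<bar> ^ n * e (s - \<omega>) n t))"
  define G where "G = (\<lambda>N. 1 / (s - \<omega> - \<bar>h\<bar>) - (\<Sum>n<N. \<bar>h\<bar> ^ n * (1 / (s - \<omega>) ^ Suc n)))"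
  have g: "(g N has_integral G N) {0<..}" for N
    unfolding g_def G_def e_def
    using has_integral_exp_moment[of "s - \<omega> - \<bar>h\<bar>" 0] h s
    by (intro has_integral_diff has_integral_sum has_integral_mult_right has_integral_exp_moment) auto
  have wg: "\<bar>w N t\<bar> * exp (\<omega> * t) \<le> g N t" if "0 < t" for N t
  proof -
    have "w N t = exp (- s * t) * (exp (h * t) - (\<Sum>n<N. (h * t) ^ n / fact n))"
      by (simp add: w_def e_def right_diff_distrib sum_distrib_left power_mult_distrib mult_ac
          left_diff_distrib exp_diff exp_minus divide_simps)
    moreover have "g N t = exp (- s * t) * exp (\<omega> * t) *
        (exp (\<bar>h * t\<bar>) - (\<Sum>n<N. \<bar>h * t\<bar> ^ n / fact n))"
      using that
      by (simp add: g_def e_def abs_mult right_diff_distrib sum_distrib_left power_mult_distrib mult_ac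
          left_diff_distrib exp_diff exp_minus divide_simps)
    ultimately show ?thesis
      using exp_taylor_tail_le[of "h * t" N] by (simp add: abs_mult mult_ac)
  qed
  have bound_N: "norm (laplace_coeff u (s - h) 0 - (\<Sum>n<N. h ^ n *\<^sub>R laplace_coeff u s n)) \<le> K * G N"
    for N
  proof -
    have int: "((\<lambda>t. e b n t *\<^sub>R u t) has_integral laplace_coeff u b n) {0<..}" if "\<omega> < b" for b n
      using integrable_integral[OF laplace_coeff_integrable(1)[OF that, of n]]
      by (simp add: e_def laplace_coeff_def)
    have "((\<lambda>t. e (s - h) 0 t *\<^sub>R u t - (\<Sum>n<N. h ^ n *\<^sub>R e s n t *\<^sub>R u t)) has_integral
        laplace_coeff u (s - h) 0 - (\<Sum>n<N. h ^ n *\<^sub>R laplace_coeff u s n)) {0<..}"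
      using s h by (intro has_integral_diff has_integral_sum has_integral_cmul int) auto
    then have L: "((\<lambda>t. w N t *\<^sub>R u t) has_integral
        laplace_coeff u (s - h) 0 - (\<Sum>n<N. h ^ n *\<^sub>R laplace_coeff u s n)) {0<..}"
      by (simp add: w_def scaleR_diff_left scaleR_sum_left)
    have "norm (integral {0<..} (\<lambda>t. w N t *\<^sub>R u t)) \<le> integral {0<..} (\<lambda>t. K * g N t)"
      using has_integral_integrable[OF has_integral_mult_right[OF g, of K]]
      by (intro Henstock_Kurzweil_Integration.integral_norm_bound_integral
          has_integral_integrable[OF L] norm_weighted_le wg) auto
    then show ?thesis
      using integral_unique[OF g, of N] integral_unique[OF L] by simp
  qed
  have "(\<lambda>n. \<bar>h\<bar> ^ n * (1 / (s - \<omega>) ^ Suc n)) sums (1 / (s - \<omega> - \<bar>h\<bar>))"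
  proof -
    have "(\<lambda>n. (1 / (s - \<omega>)) * (\<bar>h\<bar> / (s - \<omega>)) ^ n) sums ((1 / (s - \<omega>)) * (1 / (1 - \<bar>h\<bar> / (s - \<omega>))))"
      using s h by (intro sums_mult geometric_sums) simp
    moreover have "(1 / (s - \<omega>)) * (1 / (1 - \<bar>h\<bar> / (s - \<omega>))) = 1 / (s - \<omega> - \<bar>h\<bar>)"
      using s h by (simp add: field_simps)
    ultimately show ?thesis
      by (simp add: power_divide)
  qed
  from tendsto_diff[OF tendsto_const this[unfolded sums_def], of "1 / (s - \<omega> - \<bar>h\<bar>)"]
  have "G \<longlonglongrightarrow> 0"
    by (simp only: G_def diff_self)
  then have KG: "(\<lambda>N. K * G N) \<longlonglongrightarrow> 0"
    by (rule tendsto_mult_right_zero)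
  have "(\<lambda>N. laplace_coeff u (s - h) 0 - (\<Sum>n<N. h ^ n *\<^sub>R laplace_coeff u s n)) \<longlonglongrightarrow> 0"
    by (rule Lim_null_comparison[OF _ KG]) (simp only: bound_N eventually_True)
  from tendsto_diff[OF tendsto_const this, of "laplace_coeff u (s - h) 0"]
  show "(\<lambda>n. h ^ n *\<^sub>R laplace_coeff u s n) sums laplace_coeff u (s - h) 0"
    by (simp add: sums_def)
qed

end

section \<open>Resolvents at real points\<close>

lemma
  assumes "complex_of_real \<mu> \<in> resolvent_set D A"
  shows resolvent_in_domain: "resolvent D A (of_real \<mu>) x \<in> D"
    and operator_resolvent:
      "A (resolvent D A (of_real \<mu>) x) = \<mu> *\<^sub>R resolvent D A (of_real \<mu>) x - x"
    and resolvent_eqI: "\<And>y. y \<in> D \<Longrightarrow> \<mu> *\<^sub>R y - A y = x \<Longrightarrow> resolvent D A (of_real \<mu>) x = y"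
    and bounded_linear_resolvent: "bounded_linear (resolvent D A (of_real \<mu>))"
proof -
  have bij: "bij_betw (\<lambda>x. \<mu> *\<^sub>R x - A x) D UNIV"
    and bl: "bounded_clinear (resolvent D A (of_real \<mu>))"
    using assms by (auto simp: resolvent_set_def scaleC_of_real)
  have R: "resolvent D A (of_real \<mu>) = inv_into D (\<lambda>x. \<mu> *\<^sub>R x - A x)"
    by (simp add: resolvent_def scaleC_of_real)
  show "resolvent D A (of_real \<mu>) x \<in> D"
    using bij_betw_apply[OF bij_betw_inv_into[OF bij]] by (simp add: R)
  have "\<mu> *\<^sub>R resolvent D A (of_real \<mu>) x - A (resolvent D A (of_real \<mu>) x) = x"
    using bij_betw_inv_into_right[OF bij, of x] by (simp add: R)
  then show "A (resolvent D A (of_real \<mu>) x) = \<mu> *\<^sub>R resolvent D A (of_real \<mu>) x - x"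
    by (simp add: algebra_simps)
  show "resolvent D A (of_real \<mu>) x = y" if "y \<in> D" "\<mu> *\<^sub>R y - A y = x" for y
    using bij_betw_inv_into_left[OF bij that(1)] that(2) by (simp add: R)
  show "bounded_linear (resolvent D A (of_real \<mu>))"
    using bl by (simp add: bounded_clinear_def)
qed

text \<open>Stated as a fixed-point equation for \<open>Q x\<close> that mentions only the one bounded operator \<open>R\<close>. In
  this form it involves \<open>\<nu>\<close> only as a scalar and can be continued analytically to values of \<open>\<nu>\<close> not
  known beforehand to lie in the resolvent set.\<close>
lemma
  assumes \<mu>: "complex_of_real \<mu> \<in> resolvent_set D A" and \<nu>: "complex_of_real \<nu> \<in> resolvent_set D A"
  defines "R \<equiv> resolvent D A (of_real \<mu>)" and "Q \<equiv> resolvent D A (of_real \<nu>)"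
  shows resolvent_identity: "Q x = R x - (\<nu> - \<mu>) *\<^sub>R R (Q x)"
    and resolvent_commute: "Q (R x) = R (Q x)"
proof -
  interpret R: bounded_linear R
    unfolding R_def by (rule bounded_linear_resolvent[OF \<mu>])
  have Q: "Q x \<in> D" "A (Q x) = \<nu> *\<^sub>R Q x - x"
    unfolding Q_def by (simp_all add: resolvent_in_domain[OF \<nu>] operator_resolvent[OF \<nu>])
  have R: "R y \<in> D" "A (R y) = \<mu> *\<^sub>R R y - y" for y
    unfolding R_def by (simp_all add: resolvent_in_domain[OF \<mu>] operator_resolvent[OF \<mu>])
  have "R (x - (\<nu> - \<mu>) *\<^sub>R Q x) = Q x"
    unfolding R_def using Q by (intro resolvent_eqI[OF \<mu>]) (auto simp: algebra_simps)
  then show id: "Q x = R x - (\<nu> - \<mu>) *\<^sub>R R (Q x)"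
    by (simp add: R.diff R.scaleR)
  have "\<nu> *\<^sub>R R (Q x) - A (R (Q x)) = R x"
    using id by (simp add: R algebra_simps)
  then show "Q (R x) = R (Q x)"
    unfolding Q_def using R by (intro resolvent_eqI[OF \<nu>]) (auto simp: Q_def)
qed

section \<open>From the Laplace transform to the discrete family\<close>

lemma bounded_clinear_poisson_transform:
  assumes S: "\<And>t. 0 < t \<Longrightarrow> bounded_clinear (S t)"
    and bounded: "\<And>x. continuous_exp_bounded (M * norm x) \<omega> (\<lambda>t. S t x)" and "\<omega> < 1"
  shows "bounded_clinear (poisson_transform S n)"
proof -
  let ?w = "\<lambda>t::real. exp (- t) * t ^ n / fact n"
  have int: "(\<lambda>t. ?w t *\<^sub>R S t x) integrable_on {0<..}" for x
    using laplace_coeff_integrable(1)[OF bounded[of x] \<open>\<omega> < 1\<close>, of n] by simp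
  have P: "poisson_transform S n x = integral {0<..} (\<lambda>t. ?w t *\<^sub>R S t x)" for x
    by (simp add: poisson_transform_def poisson_integrand_def[abs_def])
  have add: "poisson_transform S n (x + y) = poisson_transform S n x + poisson_transform S n y" for x y
  proof -
    have "poisson_transform S n (x + y) = integral {0<..} (\<lambda>t. ?w t *\<^sub>R S t x + ?w t *\<^sub>R S t y)"
      unfolding P
    proof (rule Henstock_Kurzweil_Integration.integral_cong)
      fix t :: real assume "t \<in> {0<..}"
      then have "linear (S t)"
        using S[of t] by (auto simp: bounded_clinear_def dest: bounded_linear.linear)
      then show "?w t *\<^sub>R S t (x + y) = ?w t *\<^sub>R S t x + ?w t *\<^sub>R S t y"
        by (simp only: linear_add scaleR_add_right)
    qed
    then show ?thesis
      by (simp add: P Henstock_Kurzweil_Integration.integral_add int)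
  qed
  have scaleC: "poisson_transform S n (c *\<^sub>C x) = c *\<^sub>C poisson_transform S n x" for c x
  proof -
    have scaleC_scaleR: "r *\<^sub>R c *\<^sub>C y = c *\<^sub>C r *\<^sub>R y" for r :: real and y :: 'a
      by (simp add: scaleC_scaleC mult.commute flip: scaleC_of_real)
    have "bounded_linear (\<lambda>y::'a. c *\<^sub>C y)"
      by (rule bounded_linear_intro[where K = "cmod c"])
         (simp_all add: scaleC_add_right scaleC_scaleR norm_scaleC mult.commute)
    from integral_linear[OF int this, of x]
    have "integral {0<..} (\<lambda>t. c *\<^sub>C ?w t *\<^sub>R S t x) = c *\<^sub>C poisson_transform S n x"
      by (simp add: o_def P)
    moreover have "integral {0<..} (\<lambda>t. c *\<^sub>C ?w t *\<^sub>R S t x) = poisson_transform S n (c *\<^sub>C x)"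
      unfolding P using S
      by (intro Henstock_Kurzweil_Integration.integral_cong)
         (simp only: bounded_clinear_def scaleC_scaleR greaterThan_iff)
    ultimately show ?thesis by simp
  qed
  have "bounded_linear (poisson_transform S n)"
  proof (rule bounded_linear_intro[OF add])
    show "poisson_transform S n (r *\<^sub>R x) = r *\<^sub>R poisson_transform S n x" for r x
      using scaleC[of "of_real r"] by (simp only: scaleC_of_real)
    show "norm (poisson_transform S n x) \<le> norm x * (M / (1 - \<omega>) ^ Suc n)" for x
      using laplace_coeff_integrable(3)[OF bounded[of x] \<open>\<omega> < 1\<close>, of n]
      by (simp add: P laplace_coeff_def mult.commute)
  qed
  with scaleC show ?thesis
    by (simp add: bounded_clinear_def)
qed

theorem theorem6p3:
  fixes \<alpha> :: real
    and D :: "'a::complex_banach set"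
    and A :: "'a \<Rightarrow> 'a"
    and S :: "real \<Rightarrow> 'a \<Rightarrow> 'a"
  assumes "\<alpha> > 0"
    and "resolvent_family \<alpha> D A S"
    and "\<exists>M>0. \<exists>\<omega><1. \<forall>t>0. onorm (S t) \<le> M * exp (\<omega> * t)"
  shows "(\<forall>n x. poisson_integrand S n x integrable_on {0<..} \<and>
             (\<lambda>t. norm (poisson_integrand S n x t)) integrable_on {0<..}) \<and>
         discrete_resolvent_family \<alpha> D A (poisson_transform S)"
proof -
  have S: "bounded_clinear (S t)" if "0 < t" for t
    using assms(2) that by (auto simp: resolvent_family_def family_times_def split: if_splits)
  have cont: "continuous_on {0<..} (\<lambda>t. S t x)" for x
    using assms(2)
    by (auto simp: resolvent_family_def family_times_def split: if_splits
        intro: continuous_on_subset)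
  obtain \<omega>\<^sub>0 where "0 \<le> \<omega>\<^sub>0"
    and \<omega>\<^sub>0: "\<forall>z. Re z > \<omega>\<^sub>0 \<longrightarrow>
      z powr complex_of_real \<alpha> \<in> resolvent_set D A \<and>
      (\<forall>x. ((\<lambda>t. exp (- (z * complex_of_real t)) *\<^sub>C S t x)
             has_integral resolvent D A (z powr complex_of_real \<alpha>) x) {0<..})"
    using assms(2) by (auto simp: resolvent_family_def)
  obtain M \<omega> where "\<omega> < 1" and M: "\<And>t. 0 < t \<Longrightarrow> onorm (S t) \<le> M * exp (\<omega> * t)"
    using assms(3) by blast
  have bound: "norm (S t x) \<le> (M * norm x) * exp (\<omega> * t)" if "0 < t" for t x
  proof -
    have "norm (S t x) \<le> onorm (S t) * norm x"
      using S[OF that] by (intro onorm) (simp add: bounded_clinear_def)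
    also have "\<dots> \<le> (M * exp (\<omega> * t)) * norm x"
      using M[OF that] by (intro mult_right_mono) auto
    finally show ?thesis by (simp add: mult_ac)
  qed
  then have bounded: "continuous_exp_bounded (M * norm x) \<omega> (\<lambda>t. S t x)" for x
    using cont by (simp add: continuous_exp_bounded_def)

  define L where "L = (\<lambda>s x. laplace_coeff (\<lambda>t. S t x) s 0)"
  define P where "P = poisson_transform S"
  define Res where "Res = (\<lambda>s. resolvent D A (complex_of_real (s powr \<alpha>)))"
  have in_resolvent_set: "complex_of_real (s powr \<alpha>) \<in> resolvent_set D A" if "\<omega>\<^sub>0 < s" for s
    using \<omega>\<^sub>0[rule_format, of "of_real s"] that \<open>0 \<le> \<omega>\<^sub>0\<close> by (simp add: powr_of_real)
  have L_eq_Res: "L s x = Res s x" if "\<omega>\<^sub>0 < s" for s x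
  proof -
    have "((\<lambda>t. exp (- s * t) *\<^sub>R S t x) has_integral Res s x) {0<..}"
      using \<omega>\<^sub>0[rule_format, of "of_real s"] that \<open>0 \<le> \<omega>\<^sub>0\<close>
      by (simp add: powr_of_real Res_def flip: scaleC_of_real exp_of_real)
    then show ?thesis
      by (simp add: L_def laplace_coeff_def integral_unique)
  qed

  \<comment> \<open>Any point to the right of \<open>\<omega>\<^sub>0\<close> would do: \<open>R\<close> is the fixed resolvent through which membership in
    \<open>D\<close> and the values of \<open>A\<close> are expressed.\<close>
  define \<mu> where "\<mu> = (\<omega>\<^sub>0 + 1) powr \<alpha>"
  define R where "R = resolvent D A (of_real \<mu>)"
  have \<mu>: "of_real \<mu> \<in> resolvent_set D A"
    unfolding \<mu>_def by (rule in_resolvent_set) simp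
  interpret R: bounded_linear R
    unfolding R_def by (rule bounded_linear_resolvent[OF \<mu>])

  \<comment> \<open>The Laplace transform is analytic to the right of \<open>\<omega>\<close>, the power \<open>s\<^sup>-\<^sup>\<alpha>\<close> to the right of
    \<open>0\<close>.\<close>
  define a where "a = max \<omega> 0"
  have a: "0 \<le> a" "a < 1"
    using \<open>\<omega> < 1\<close> by (auto simp: a_def)
  let ?c = "\<lambda>x. laplace_coeff (\<lambda>t. S t x)"
  let ?k = "\<lambda>s n. s powr (- \<alpha> - real n) * cesaro_kernel \<alpha> n"
  have P: "?c x 1 n = P n x" for x n
    by (simp add: P_def poisson_transform_def poisson_integrand_def[abs_def] laplace_coeff_def)
  have L: "taylor_on_ray a (\<lambda>s. L s x) (?c x)" for x
    unfolding L_def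
    by (rule taylor_on_ray_mono[OF taylor_on_ray_laplace[OF bounded]]) (simp_all add: a_def)
  have RL: "taylor_on_ray a (\<lambda>s. R (L s x)) (\<lambda>s n. R (?c x s n))" for x
    by (rule taylor_on_ray_bounded_linear[OF R.bounded_linear_axioms L])
  note k = taylor_on_ray_powr[OF \<open>\<alpha> > 0\<close> a(1)]

  have P_R: "P n (R x) = R (P n x)" for n x
  proof -
    have "L s (R x) = R (L s x)" if "\<omega>\<^sub>0 < s" for s
      unfolding L_eq_Res[OF that] Res_def R_def
      by (rule resolvent_commute[OF \<mu> in_resolvent_set[OF that]])
    then have "\<forall>s>\<omega>\<^sub>0. L s (R x) = R (L s x)"
      by blast
    from taylor_on_ray_identity[OF L RL this a(2), of n] show ?thesis
      by (simp add: P)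
  qed

  \<comment> \<open>The equation below exhibits \<open>W n x\<close> as a value of \<open>R\<close>, from which \<open>A (W n x)\<close> can be read off. It
    compares the coefficients at \<open>1\<close> of the resolvent identity multiplied by \<open>s\<^sup>-\<^sup>\<alpha>\<close>.\<close>
  define W where "W = seq_conv (cesaro_kernel \<alpha>) P"
  have W_eq: "W n x = R (cesaro_kernel \<alpha> n *\<^sub>R x - P n x + \<mu> *\<^sub>R W n x)" for n x
  proof -
    let ?w = "\<lambda>s n. \<Sum>j=0..n. ?k s (n - j) *\<^sub>R ?c x s j"
    have kL: "taylor_on_ray a (\<lambda>s. s powr - \<alpha> *\<^sub>R L s x) ?w"
      by (rule taylor_on_ray_scaleR[OF k L])
    have W: "?w 1 n = W n x"
      by (simp add: W_def seq_conv_def P)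
    have lhs: "taylor_on_ray a (\<lambda>s. s powr - \<alpha> *\<^sub>R L s x + R (L s x)) (\<lambda>s n. ?w s n + R (?c x s n))"
      by (rule taylor_on_ray_add[OF kL RL])
    have rhs: "taylor_on_ray a (\<lambda>s. s powr - \<alpha> *\<^sub>R R x + \<mu> *\<^sub>R R (s powr - \<alpha> *\<^sub>R L s x))
        (\<lambda>s n. ?k s n *\<^sub>R R x + \<mu> *\<^sub>R R (?w s n))"
      by (intro taylor_on_ray_add taylor_on_ray_bounded_linear[OF _ k]
          taylor_on_ray_bounded_linear[OF _ kL] bounded_linear_intros
          bounded_linear_compose[OF bounded_linear_scaleR_right R.bounded_linear_axioms])
    have "s powr - \<alpha> *\<^sub>R L s x + R (L s x) = s powr - \<alpha> *\<^sub>R R x + \<mu> *\<^sub>R R (s powr - \<alpha> *\<^sub>R L s x)"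
      if "\<omega>\<^sub>0 < s" for s
    proof -
      have inv: "s powr - \<alpha> * s powr \<alpha> = 1"
        using that \<open>0 \<le> \<omega>\<^sub>0\<close> by (simp flip: powr_add)
      have "L s x = R x - (s powr \<alpha> - \<mu>) *\<^sub>R R (L s x)"
        unfolding L_eq_Res[OF that] Res_def R_def
        by (rule resolvent_identity[OF \<mu> in_resolvent_set[OF that]])
      then have "s powr - \<alpha> *\<^sub>R L s x = s powr - \<alpha> *\<^sub>R (R x - (s powr \<alpha> - \<mu>) *\<^sub>R R (L s x))"
        by simp
      also have "\<dots> = s powr - \<alpha> *\<^sub>R R x - (s powr - \<alpha> * s powr \<alpha>) *\<^sub>R R (L s x)
          + \<mu> *\<^sub>R R (s powr - \<alpha> *\<^sub>R L s x)"
        by (simp only: R.scaleR) (simp add: algebra_simps)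
      finally have eq: "s powr - \<alpha> *\<^sub>R L s x = s powr - \<alpha> *\<^sub>R R x - R (L s x)
          + \<mu> *\<^sub>R R (s powr - \<alpha> *\<^sub>R L s x)"
        by (simp only: inv scaleR_one)
      show ?thesis
        by (subst eq) simp
    qed
    then have "\<forall>s>\<omega>\<^sub>0. s powr - \<alpha> *\<^sub>R L s x + R (L s x) =
        s powr - \<alpha> *\<^sub>R R x + \<mu> *\<^sub>R R (s powr - \<alpha> *\<^sub>R L s x)"
      by blast
    from taylor_on_ray_identity[OF lhs rhs this a(2), of n]
    have "W n x + R (P n x) = cesaro_kernel \<alpha> n *\<^sub>R R x + \<mu> *\<^sub>R R (W n x)"
      unfolding W by (simp add: P)
    then show ?thesis
      by (simp add: R.add R.diff R.scaleR algebra_simps)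
  qed

  have R: "R y \<in> D" "A (R y) = \<mu> *\<^sub>R R y - y" for y
    unfolding R_def by (rule resolvent_in_domain[OF \<mu>], rule operator_resolvent[OF \<mu>])
  have "W n x \<in> D \<and> P n x = cesaro_kernel \<alpha> n *\<^sub>R x + A (W n x)" for n x
  proof -
    define y where "y = cesaro_kernel \<alpha> n *\<^sub>R x - P n x + \<mu> *\<^sub>R W n x"
    have W_eq_R: "W n x = R y"
      unfolding y_def by (rule W_eq)
    have "A (W n x) = \<mu> *\<^sub>R W n x - y"
      unfolding W_eq_R by (rule R(2))
    moreover have "W n x \<in> D"
      unfolding W_eq_R by (rule R(1))
    ultimately show ?thesis
      by (simp add: y_def)
  qed
  moreover have bl: "bounded_clinear (P n)" for n
    unfolding P_def using S bounded \<open>\<omega> < 1\<close> by (rule bounded_clinear_poisson_transform)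
  moreover have "P n x \<in> D \<and> P n (A x) = A (P n x)" if "x \<in> D" for n x
  proof -
    interpret P: bounded_linear "P n"
      using bl by (simp add: bounded_clinear_def)
    define y where "y = \<mu> *\<^sub>R x - A x"
    have x: "x = R y"
      unfolding R_def using that by (intro resolvent_eqI[OF \<mu>, symmetric]) (auto simp: y_def)
    have "P n (A x) = \<mu> *\<^sub>R P n x - P n y"
      unfolding x R by (simp add: P.diff P.scaleR)
    then show ?thesis
      using R[of "P n y"] by (simp add: x P_R)
  qed
  ultimately have "discrete_resolvent_family \<alpha> D A P"
    by (auto simp: discrete_resolvent_family_def W_def)
  moreover have "poisson_integrand S n x integrable_on {0<..}"
    and "(\<lambda>t. norm (poisson_integrand S n x t)) integrable_on {0<..}" for n x
    using laplace_coeff_integrable(1,2)[OF bounded[of x] \<open>\<omega> < 1\<close>, of n]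
    by (simp_all add: poisson_integrand_def[abs_def] del: norm_scaleR)
  ultimately show ?thesis
    by (simp add: P_def)
qed

end
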